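(* As formal power series in $x,y$, $$\sum_{m,n\ge0} \left|\mathcal{IC}([m]\times[n])\right|\, x^m y^n=\frac{2}{1-x-y+2xy+\sqrt{(1-x-y)^2-4xy}}.$$
   Context: For a finite poset $P$, a subset $I\subseteq P$ is an interval-closed set (ICS) if for all $a,b\in I$ and $z\in P$ with $a<z<b$ we have $z\in I$; $\mathcal{IC}(P)$ denotes the set of all interval-closed sets of $P$ (including the empty set). $[n]$ is the chain $1<2<\cdots<n$, and $[m]\times[n]=\{(i,j): 1\le i\le m,\ 1\le j\le n\}$ is ordered by $(a,b)\le(c,d)$ iff $a\le c$ and $b\le d$. When $m=0$ or $n=0$ the poset is empty, and has exactly one ICS, the empty set. The square root denotes the formal power series with constant term $1$. *)

theory Defs
  imports
    Complex_Main
    "HOL-Library.Product_Order"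
    "HOL-Computational_Algebra.Formal_Power_Series"
begin

unbundle fps_syntax

definition interval_closed_sets :: "'a::order set \<Rightarrow> 'a set set"  ("\<I>\<C>") where
  "\<I>\<C> P = {I. I \<subseteq> P \<and> (\<forall>a\<in>I. \<forall>b\<in>I. \<forall>z\<in>P. a < z \<and> z < b \<longrightarrow> z \<in> I)}"

text \<open>The order on \<^typ>\<open>nat \<times> nat\<close> is the componentwise one of \<^theory>\<open>HOL-Library.Product_Order\<close>.\<close>

definition chain_product :: "nat \<Rightarrow> nat \<Rightarrow> (nat \<times> nat) set" where
  "chain_product m n = {1..m} \<times> {1..n}"

text \<open>
  Bivariate power series are iterated univariate ones: the coefficient of $x^m y^n$ in
  \<open>F\<close> is \<open>F $ m $ n\<close>.
\<close>

definition fps_x :: "rat fps fps" where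
  "fps_x = fps_X"

definition fps_y :: "rat fps fps" where
  "fps_y = fps_const fps_X"

lemma fps_xy_monomial_nth:
  "(fps_x ^ i * fps_y ^ j) $ m $ n = (if m = i \<and> n = j then 1 else 0)"
proof -
  have "fps_x ^ i * fps_y ^ j = fps_X ^ i * fps_const (fps_X ^ j)"
    by (simp only: fps_x_def fps_y_def fps_const_power)
  then show ?thesis
    by (simp only: fps_mult_right_const_nth fps_X_power_nth) simp
qed

text \<open>
  The function \<open>fps_radical\<close> of the library needs coefficients in a field, so it does not
  apply to iterated series.  The next definition is meaningful for series with constant
  term 1; see \<open>fps2_sqrt\<close> below.
\<close>

definition fps2_sqrt :: "rat fps fps \<Rightarrow> rat fps fps" where
  "fps2_sqrt F = (THE S. S\<^sup>2 = F \<and> S $ 0 $ 0 = 1)"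

fun fps_root_coeff :: "'a::comm_ring_1 fps \<Rightarrow> 'a \<Rightarrow> 'a \<Rightarrow> nat \<Rightarrow> 'a" where
  "fps_root_coeff f a h 0 = a"
| "fps_root_coeff f a h (Suc n) =
     h * (f $ Suc n - (\<Sum>i\<in>{1..n}. fps_root_coeff f a h i * fps_root_coeff f a h (Suc n - i)))"

lemma fps_root_exists:
  fixes f :: "'a::comm_ring_1 fps"
  assumes "f $ 0 = a\<^sup>2" and "2 * a * h = 1"
  shows "\<exists>g. g\<^sup>2 = f \<and> g $ 0 = a"
proof -
  define c where "c = fps_root_coeff f a h"
  have "(Abs_fps c)\<^sup>2 $ n = f $ n" for n
  proof (cases n)
    case 0
    then show ?thesis using assms by (simp add: c_def power2_eq_square)
  next
    case (Suc k)
    define S where "S = (\<Sum>i\<in>{1..k}. c i * c (Suc k - i))"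
    have c0: "c 0 = a" by (simp add: c_def)
    have cS: "c (Suc k) = h * (f $ Suc k - S)"
      by (simp add: c_def S_def)
    have "(Abs_fps c)\<^sup>2 $ n = (\<Sum>i=0..Suc k. c i * c (Suc k - i))"
      by (simp add: power2_eq_square fps_mult_nth Suc)
    also have "\<dots> = a * c (Suc k) + S + c (Suc k) * a"
      by (simp add: sum.atLeast_Suc_atMost S_def c0)
    also have "\<dots> = (2 * a * h) * (f $ Suc k - S) + S"
      by (simp add: cS algebra_simps)
    finally show ?thesis using assms(2) Suc by simp
  qed
  then have "(Abs_fps c)\<^sup>2 = f" by (simp add: fps_ext)
  moreover have "Abs_fps c $ 0 = a" by (simp add: c_def)
  ultimately show ?thesis by blast
qed

lemma fps2_sqrt_unique:
  fixes S T :: "rat fps fps"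
  assumes "S\<^sup>2 = T\<^sup>2" "S $ 0 $ 0 = 1" "T $ 0 $ 0 = 1"
  shows "S = T"
proof -
  have "(S + T) $ 0 $ 0 = 2" using assms by simp
  then have "S + T \<noteq> 0" by (metis fps_zero_nth zero_neq_numeral)
  moreover have "(S - T) * (S + T) = 0"
    using assms(1) by (simp add: algebra_simps power2_eq_square)
  ultimately show ?thesis by simp
qed

lemma fps2_sqrt:
  assumes "F $ 0 $ 0 = 1"
  shows "(fps2_sqrt F)\<^sup>2 = F" and "fps2_sqrt F $ 0 $ 0 = 1"
proof -
  obtain a :: "rat fps" where a: "a\<^sup>2 = F $ 0" "a $ 0 = 1"
    using fps_root_exists[of "F $ 0" 1 "1/2"] assms by auto
  have "2 * a * inverse (2 * a) = 1"
    by (rule inverse_mult_eq_1') (simp add: a fps_numeral_nth)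
  then obtain S :: "rat fps fps" where "S\<^sup>2 = F" "S $ 0 = a"
    using fps_root_exists[of F a "inverse (2 * a)"] a by auto
  then have S: "S\<^sup>2 = F \<and> S $ 0 $ 0 = 1" using a by simp
  have "T = S" if "T\<^sup>2 = F \<and> T $ 0 $ 0 = 1" for T
    using S that by (auto intro: fps2_sqrt_unique[of T S])
  with S have "(fps2_sqrt F)\<^sup>2 = F \<and> fps2_sqrt F $ 0 $ 0 = 1"
    unfolding fps2_sqrt_def by (rule theI)
  then show "(fps2_sqrt F)\<^sup>2 = F" and "fps2_sqrt F $ 0 $ 0 = 1" by auto
qed

text \<open>The library's division on iterated series is exact when the divisor has nonzero constant term.\<close>

lemma fps2_divide_eq_iff:
  fixes F G H :: "rat fps fps"
  assumes "H $ 0 $ 0 \<noteq> 0"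
  shows "F = G / H \<longleftrightarrow> F * H = G"
proof -
  have H0: "H $ 0 \<noteq> 0" using assms by auto
  have "H $ 0 * inverse (H $ 0) = 1"
    using assms by (rule inverse_mult_eq_1')
  then have inv: "H * inverse H = 1"
    unfolding fps_inverse_def by (rule fps_right_inverse)
  have "G / H = G * inverse H" using H0 by (rule fps_divide_unit)
  then show ?thesis using inv by (auto simp: mult.assoc mult.commute[of "inverse H"])
qed

end

theory Submission
  imports Defs
begin

text \<open>
  Counting the interval-closed sets of a rectangle by removing the first row does not give a
  closed recurrence, because the first row restricts the rest.  All that the rest has to know is
  which interval \<open>{b<..a}\<close> the row above it occupies.  This leads to the family
  \<open>ics_below m a b\<close> of the sets that can be placed in \<open>m\<close> rows of length \<open>a\<close> below a row
  occupied exactly in \<open>{b<..a}\<close>; when \<open>b = a\<close> that row is empty and nothing is imposed.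

  Let \<open>d m a b\<close> be the size of this family.  For \<open>b < a\<close> every member either avoids column
  \<open>a\<close>, or also fits below the longer row \<open>{b - 1<..a}\<close>, or has first row exactly
  \<open>{b<..a}\<close>; in the last case removing that row leaves a member of the family with one
  row fewer.  For \<open>0 < b\<close>, inclusion-exclusion gives
  \<open>d (m+1) a b = d (m+1) (a-1) b + d (m+1) a (b-1) - d (m+1) (a-1) (b-1) + d m a b\<close>,
  and for \<open>b = 0\<close> the terms with \<open>b-1\<close> are absent.
  For \<open>b = a\<close> every member either fits below the row \<open>{a}\<close> or has empty first row, and
  the two cases overlap in the sets with empty first row that avoid column \<open>a\<close>.

  In terms of \<open>R k = (\<Sum>m n. d m (n + k) n * x ^ m * y ^ n)\<close> these recurrences are linear with
  constant coefficients in \<open>k\<close>: \<open>R (k+1) = R k + x * R (k+1) + y * R (k+2) - y * R (k+1)\<close> and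
  \<open>R 0 = 1 + x * R 0 - x * y * R 0 + y * R 1\<close>.  They determine all coefficients
  (\<open>ics_below_series\<close>), so it suffices to exhibit a solution, and a geometric one exists:
  \<open>R k = F * t ^ k\<close> with \<open>t = 1 + x * t + y * t\<^sup>2 - y * t\<close> and
  \<open>F * (1 - x + x * y - y * t) = 1\<close>.  Dividing by \<open>y\<close> to solve for \<open>t\<close> is avoided by writing
  \<open>t = 1 + x * M\<close>, where \<open>M = 2 / (1 - x - y + S)\<close> with
  \<open>S\<^sup>2 = (1 - x - y)\<^sup>2 - 4 * x * y\<close> solves \<open>M = 1 + (x + y) * M + x * y * M\<^sup>2\<close>; this is the
  generating function of two-coloured Motzkin paths.  Then \<open>F\<close> is the asserted quotient, and
  \<open>R 0\<close> is the series to be computed.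
\<close>

section \<open>Interval-closed sets below a given row\<close>

text \<open>
  Convexity for the weak order needs no ambient poset once the set lies in a rectangle, since all
  points between two points of a rectangle are in it.
\<close>

definition box_convex :: "(nat \<times> nat) set \<Rightarrow> bool" where
  "box_convex I \<longleftrightarrow> (\<forall>i j k l p q. (i, j) \<in> I \<longrightarrow> (k, l) \<in> I \<longrightarrow>
     i \<le> p \<longrightarrow> p \<le> k \<longrightarrow> j \<le> q \<longrightarrow> q \<le> l \<longrightarrow> (p, q) \<in> I)"

lemma box_convexD:
  "box_convex I \<Longrightarrow> (i, j) \<in> I \<Longrightarrow> (k, l) \<in> I \<Longrightarrow> i \<le> p \<Longrightarrow> p \<le> k \<Longrightarrow> j \<le> q \<Longrightarrow> q \<le> l \<Longrightarrow> (p, q) \<in> I"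
  unfolding box_convex_def by blast

lemma interval_closed_sets_chain_product:
  "\<I>\<C> (chain_product m n) = {I. I \<subseteq> {1..m} \<times> {1..n} \<and> box_convex I}"
proof -
  have "(\<forall>a\<in>I. \<forall>b\<in>I. \<forall>z\<in>{1..m} \<times> {1..n}. a < z \<and> z < b \<longrightarrow> z \<in> I) \<longleftrightarrow> box_convex I" (is "?L \<longleftrightarrow> _")
    if I: "I \<subseteq> {1..m} \<times> {1..n}" for I
  proof
    assume L: ?L
    show "box_convex I"
      unfolding box_convex_def
    proof (intro allI impI)
      fix i j k l p q
      assume *: "(i, j) \<in> I" "(k, l) \<in> I" "i \<le> p" "p \<le> k" "j \<le> q" "q \<le> l"
      have "1 \<le> i" "k \<le> m" "1 \<le> j" "l \<le> n" using I *(1,2) by auto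
      then have z: "(p, q) \<in> {1..m} \<times> {1..n}" using * by auto
      have le: "(i, j) \<le> (p, q)" "(p, q) \<le> (k, l)" using * by auto
      show "(p, q) \<in> I"
      proof (cases "(p, q) = (i, j) \<or> (p, q) = (k, l)")
        case True
        then show ?thesis using *(1,2) by metis
      next
        case False
        then have "(i, j) < (p, q)" "(p, q) < (k, l)" using le by (auto simp: order_less_le)
        then show ?thesis using L z *(1,2) by blast
      qed
    qed
  next
    assume "box_convex I"
    then have "z \<in> I" if "a \<in> I" "b \<in> I" "a < z" "z < b" for a b z
      using that box_convexD[of I "fst a" "snd a" "fst b" "snd b" "fst z" "snd z"]
      by (simp add: less_prod_def less_eq_prod_def)
    then show ?L by blast
  qed
  then show ?thesis
    unfolding interval_closed_sets_def chain_product_def by blast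
qed

text \<open>
  For \<open>b \<le> a\<close>, the condition says that \<open>I\<close> together with the cells \<open>(0, k)\<close>, \<open>b < k \<le> a\<close>,
  is still convex: between \<open>(0, k)\<close> and a point \<open>(i, j)\<close> of \<open>I\<close> lies \<open>(1, k)\<close>, and once this
  cell is in \<open>I\<close>, convexity of \<open>I\<close> supplies everything else in between.
\<close>

definition ics_below :: "nat \<Rightarrow> nat \<Rightarrow> nat \<Rightarrow> (nat \<times> nat) set set" where
  "ics_below m a b = {I \<in> \<I>\<C> (chain_product m a).
     \<forall>i j k. (i, j) \<in> I \<longrightarrow> b < k \<longrightarrow> k \<le> j \<longrightarrow> (1, k) \<in> I}"

lemma ics_belowI:
  assumes "\<And>i j. (i, j) \<in> I \<Longrightarrow> 1 \<le> i \<and> i \<le> m \<and> 1 \<le> j \<and> j \<le> a"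
    and "box_convex I"
    and "\<And>i j k. (i, j) \<in> I \<Longrightarrow> b < k \<Longrightarrow> k \<le> j \<Longrightarrow> (1, k) \<in> I"
  shows "I \<in> ics_below m a b"
proof -
  have "I \<subseteq> {1..m} \<times> {1..a}" using assms(1) by fastforce
  then show ?thesis
    unfolding ics_below_def interval_closed_sets_chain_product using assms(2,3) by blast
qed

lemma
  assumes "I \<in> ics_below m a b"
  shows ics_below_convex: "box_convex I"
    and ics_below_bounds: "(i, j) \<in> I \<Longrightarrow> 1 \<le> i \<and> i \<le> m \<and> 1 \<le> j \<and> j \<le> a"
    and ics_below_row: "(i, j) \<in> I \<Longrightarrow> b < k \<Longrightarrow> k \<le> j \<Longrightarrow> (1, k) \<in> I"
proof -
  have *: "I \<subseteq> {1..m} \<times> {1..a}" "box_convex I"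
      "\<forall>i j k. (i, j) \<in> I \<longrightarrow> b < k \<longrightarrow> k \<le> j \<longrightarrow> (1, k) \<in> I"
    using assms unfolding ics_below_def interval_closed_sets_chain_product by blast+
  show "box_convex I" by (fact *(2))
  show "(i, j) \<in> I \<Longrightarrow> 1 \<le> i \<and> i \<le> m \<and> 1 \<le> j \<and> j \<le> a"
    using *(1) by auto
  show "(i, j) \<in> I \<Longrightarrow> b < k \<Longrightarrow> k \<le> j \<Longrightarrow> (1, k) \<in> I"
    using *(3) by blast
qed

lemma finite_ics_below [simp]: "finite (ics_below m a b)"
proof (rule finite_subset)
  show "ics_below m a b \<subseteq> Pow ({1..m} \<times> {1..a})"
    unfolding ics_below_def interval_closed_sets_chain_product by blast
qed simp

lemma ics_below_diagonal: "ics_below m n n = \<I>\<C> (chain_product m n)"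
proof -
  have "\<not> n < k" if "I \<subseteq> {1..m} \<times> {1..n}" "(i, j) \<in> I" "k \<le> j" for I i j k
    using that by auto
  then show ?thesis
    unfolding ics_below_def interval_closed_sets_chain_product by blast
qed

lemma ics_below_empty:
  assumes "m = 0 \<or> a = 0"
  shows "ics_below m a b = {{}}"
proof -
  have "I = {}" if "I \<in> ics_below m a b" for I
    using ics_below_bounds[OF that] assms by fastforce
  moreover have "{} \<in> ics_below m a b"
    by (rule ics_belowI) (auto simp: box_convex_def)
  ultimately show ?thesis by blast
qed

definition prepend_row :: "nat set \<Rightarrow> (nat \<times> nat) set \<Rightarrow> (nat \<times> nat) set" where
  "prepend_row A I = {(i, j). i = 1 \<and> j \<in> A \<or> (\<exists>i'. i = Suc i' \<and> (i', j) \<in> I)}"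

definition ics_first_row :: "nat \<Rightarrow> nat \<Rightarrow> nat \<Rightarrow> (nat \<times> nat) set set" where
  "ics_first_row m a b = {I \<in> ics_below m a b. \<forall>j. (1, j) \<in> I \<longleftrightarrow> b < j \<and> j \<le> a}"

text \<open>
  If the first row equals the row that is imposed above it, then it imposes the same condition on
  the rows below it.  So the first row can be removed, and put back, freely.
\<close>

lemma card_ics_first_row:
  assumes "b \<le> a"
  shows "card (ics_first_row (Suc m) a b) = card (ics_below m a b)"
proof -
  define del where "del I = {(i :: nat, j :: nat). 1 \<le> i \<and> (Suc i, j) \<in> I}" for I
  have "bij_betw (prepend_row {b<..a}) (ics_below m a b) (ics_first_row (Suc m) a b)"
  proof (rule bij_betw_byWitness[where f' = del])
    show "\<forall>I\<in>ics_below m a b. del (prepend_row {b<..a} I) = I"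
      by (auto simp: del_def prepend_row_def dest: ics_below_bounds)
    show "\<forall>I\<in>ics_first_row (Suc m) a b. prepend_row {b<..a} (del I) = I"
    proof
      fix I assume I: "I \<in> ics_first_row (Suc m) a b"
      then have pos: "1 \<le> i" if "(i, j) \<in> I" for i j
        using that ics_below_bounds by (auto simp: ics_first_row_def)
      have "(i, j) \<in> prepend_row {b<..a} (del I) \<longleftrightarrow> (i, j) \<in> I" for i j
      proof (cases "i \<le> 1")
        case True
        then have "i = 0 \<or> i = 1" by auto
        then show ?thesis
          using I pos[of 0 j] by (auto simp: ics_first_row_def prepend_row_def del_def)
      next
        case False
        then obtain k where "i = Suc k" "1 \<le> k" by (cases i) auto
        then show ?thesis by (simp add: prepend_row_def del_def)
      qed
      then show "prepend_row {b<..a} (del I) = I" by auto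
    qed
    show "prepend_row {b<..a} ` ics_below m a b \<subseteq> ics_first_row (Suc m) a b"
    proof (intro image_subsetI)
      fix I assume I: "I \<in> ics_below m a b"
      note sub = ics_below_bounds[OF I] and conv = ics_below_convex[OF I]
        and row = ics_below_row[OF I]
      let ?I = "prepend_row {b<..a} I"
      have mem: "(Suc i, j) \<in> ?I \<longleftrightarrow> i = 0 \<and> b < j \<and> j \<le> a \<or> (i, j) \<in> I" for i j
        by (auto simp: prepend_row_def)
      \<comment> \<open>Everything between a cell of the new row and a point of \<open>I\<close> is in \<open>I\<close>.\<close>
      have row': "(p, q) \<in> I" if "b < q" "q \<le> l" "(k, l) \<in> I" "1 \<le> p" "p \<le> k" for p q k l
        using row[OF that(3,1,2)] that box_convexD[OF conv, of 1 q k l p q] by simp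
      have "box_convex ?I"
        unfolding box_convex_def
      proof (intro allI impI)
        fix i j k l p q
        assume *: "(i, j) \<in> ?I" "(k, l) \<in> ?I" "i \<le> p" "p \<le> k" "j \<le> q" "q \<le> l"
        obtain i' where i': "i = Suc i'" using *(1) by (auto simp: prepend_row_def)
        then obtain k' p' where kp: "k = Suc k'" "p = Suc p'" using *(3,4)
          by (metis Suc_le_D le_trans)
        have 1: "i' = 0 \<and> b < j \<and> j \<le> a \<or> (i', j) \<in> I"
          and 2: "k' = 0 \<and> b < l \<and> l \<le> a \<or> (k', l) \<in> I"
          using *(1,2) by (simp_all add: i' kp mem)
        have la: "l \<le> a" using 2 sub by auto
        have le: "i' \<le> p'" "p' \<le> k'" using * by (auto simp: i' kp)
        show "(p, q) \<in> ?I"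
        proof (cases "(i', j) \<in> I")
          case True
          then have "1 \<le> i'" using sub by auto
          then have "(k', l) \<in> I" using 2 le by auto
          then show ?thesis using box_convexD[OF conv True, of k' l p' q] le * by (simp add: kp mem)
        next
          case False
          then have "b < q" "i' = 0" using 1 * by auto
          show ?thesis
          proof (cases "p' = 0")
            case True
            then show ?thesis using \<open>b < q\<close> la * by (simp add: kp mem)
          next
            case False
            then have "(k', l) \<in> I" using 2 le by auto
            then show ?thesis using row'[of q l k' p'] \<open>b < q\<close> False le * by (simp add: kp mem)
          qed
        qed
      qed
      moreover have bounds: "1 \<le> i \<and> i \<le> Suc m \<and> 1 \<le> j \<and> j \<le> a" if "(i, j) \<in> ?I" for i j
        using that sub by (fastforce simp: prepend_row_def)
      moreover have first: "(1, j) \<in> ?I \<longleftrightarrow> b < j \<and> j \<le> a" for j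
        using sub[of 0 j] mem[of 0 j] by auto
      moreover have "(1, k) \<in> ?I" if "(i, j) \<in> ?I" "b < k" "k \<le> j" for i j k
        using bounds[OF that(1)] that first by simp
      ultimately show "?I \<in> ics_first_row (Suc m) a b"
        unfolding ics_first_row_def by (blast intro: ics_belowI)
    qed
    show "del ` ics_first_row (Suc m) a b \<subseteq> ics_below m a b"
    proof (intro image_subsetI)
      fix I assume "I \<in> ics_first_row (Suc m) a b"
      then have I: "I \<in> ics_below (Suc m) a b" by (simp add: ics_first_row_def)
      note sub = ics_below_bounds[OF I] and conv = ics_below_convex[OF I]
        and row = ics_below_row[OF I]
      have "(Suc 1, k) \<in> I" if "(Suc i, j) \<in> I" "1 \<le> i" "b < k" "k \<le> j" for i j k
        using row[OF that(1,3,4)] that box_convexD[OF conv, of 1 k "Suc i" j "Suc 1" k] by simp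
      then have "(1, k) \<in> del I" if "(i, j) \<in> del I" "b < k" "k \<le> j" for i j k
        using that by (auto simp: del_def)
      moreover have "box_convex (del I)"
        unfolding box_convex_def del_def
        by (auto intro: box_convexD[OF conv])
      moreover have "1 \<le> i \<and> i \<le> m \<and> 1 \<le> j \<and> j \<le> a" if "(i, j) \<in> del I" for i j
        using that sub[of "Suc i" j] by (auto simp: del_def)
      ultimately show "del I \<in> ics_below m a b"
        by (blast intro: ics_belowI)
    qed
  qed
  then show ?thesis by (metis bij_betw_same_card)
qed

section \<open>Recurrences for the numbers of these sets\<close>

lemma ics_below_mono:
  assumes "a \<le> a'" "b \<le> b'"
  shows "ics_below m a b \<subseteq> ics_below m a' b'"
proof
  fix I assume I: "I \<in> ics_below m a b"
  show "I \<in> ics_below m a' b'"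
  proof (rule ics_belowI)
    show "1 \<le> i \<and> i \<le> m \<and> 1 \<le> j \<and> j \<le> a'" if "(i, j) \<in> I" for i j
      using ics_below_bounds[OF I that] assms by simp
    show "(1, k) \<in> I" if "(i, j) \<in> I" "b' < k" "k \<le> j" for i j k
      using ics_below_row[OF I that(1), of k] that assms by simp
  qed (rule ics_below_convex[OF I])
qed

lemma ics_below_Int:
  assumes "b \<le> b'" "a \<le> a'"
  shows "ics_below m a b' \<inter> ics_below m a' b = ics_below m a b"
proof
  show "ics_below m a b' \<inter> ics_below m a' b \<subseteq> ics_below m a b"
  proof
    fix I assume "I \<in> ics_below m a b' \<inter> ics_below m a' b"
    then have I: "I \<in> ics_below m a b'" "I \<in> ics_below m a' b" by auto
    show "I \<in> ics_below m a b"
    proof (rule ics_belowI)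
      show "1 \<le> i \<and> i \<le> m \<and> 1 \<le> j \<and> j \<le> a" if "(i, j) \<in> I" for i j
        by (rule ics_below_bounds[OF I(1) that])
      show "(1, k) \<in> I" if "(i, j) \<in> I" "b < k" "k \<le> j" for i j k
        by (rule ics_below_row[OF I(2) that])
    qed (rule ics_below_convex[OF I(1)])
  qed
  show "ics_below m a b \<subseteq> ics_below m a b' \<inter> ics_below m a' b"
    using assms by (simp add: ics_below_mono)
qed

lemma ics_below_last_column:
  assumes "I \<in> ics_below m (Suc a) b" "I \<notin> ics_below m a b"
  obtains i where "(i, Suc a) \<in> I"
proof -
  have "I \<in> ics_below m a b" if "\<And>i. (i, Suc a) \<notin> I"
  proof (rule ics_belowI)
    show "1 \<le> i \<and> i \<le> m \<and> 1 \<le> j \<and> j \<le> a" if "(i, j) \<in> I" for i j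
      using ics_below_bounds[OF assms(1) that] \<open>(i, Suc a) \<notin> I\<close> that by (auto simp: le_Suc_eq)
    show "(1, k) \<in> I" if "(i, j) \<in> I" "b < k" "k \<le> j" for i j k
      by (rule ics_below_row[OF assms(1) that])
  qed (rule ics_below_convex[OF assms(1)])
  then show thesis using assms(2) that by blast
qed

text \<open>
  The conditions for \<open>b\<close> and \<open>b + 1\<close> differ only in column \<open>b + 1\<close>, so a set that
  satisfies only the second one fails there.
\<close>

lemma ics_below_violation:
  assumes "I \<in> ics_below m a (Suc b)" "I \<notin> ics_below m a b"
  obtains i j where "(i, j) \<in> I" "b < j" "(1, Suc b) \<notin> I"
proof -
  have "I \<in> ics_below m a b"
    if "\<And>i j k. (i, j) \<in> I \<Longrightarrow> b < k \<Longrightarrow> k \<le> j \<Longrightarrow> (1, k) \<in> I"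
  proof (rule ics_belowI)
    show "1 \<le> i \<and> i \<le> m \<and> 1 \<le> j \<and> j \<le> a" if "(i, j) \<in> I" for i j
      by (rule ics_below_bounds[OF assms(1) that])
  qed (fact ics_below_convex[OF assms(1)], fact that)
  then obtain i j k where *: "(i, j) \<in> I" "b < k" "k \<le> j" "(1, k) \<notin> I"
    using assms(2) by blast
  moreover have "k = Suc b"
    using * ics_below_row[OF assms(1) *(1) _ *(3)] by (cases "Suc b < k") auto
  ultimately show thesis using that[of i j] by simp
qed

text \<open>
  A point in the last column forces the first row to contain \<open>{b<..a + 1}\<close>.  A set that fails
  the condition for \<open>b - 1\<close> lacks \<open>(1, b)\<close>, and then by convexity of the first row also
  everything to the left of it.  For \<open>b = 0\<close> there is nothing to the left, hence the case
  distinction.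
\<close>

lemma ics_first_row_eq:
  assumes b: "b \<le> a"
  shows "ics_first_row m (Suc a) b =
     ics_below m (Suc a) b - (ics_below m a b \<union> (if b = 0 then {} else ics_below m (Suc a) (b - 1)))"
    (is "?Y = ?X - (?U \<union> ?V)")
proof (intro equalityI subsetI)
  fix I assume "I \<in> ?Y"
  then have I: "I \<in> ?X" and row: "\<And>j. (1, j) \<in> I \<longleftrightarrow> b < j \<and> j \<le> Suc a"
    by (auto simp: ics_first_row_def)
  have in1: "(1, Suc a) \<in> I" using row b by simp
  have "I \<notin> ?U" using ics_below_bounds[of I m a b, OF _ in1] by auto
  moreover have "(1, b) \<notin> I" using row by simp
  then have "I \<notin> ?V" using ics_below_row[of I m "Suc a" "b - 1", OF _ in1, of b] b by auto
  ultimately show "I \<in> ?X - (?U \<union> ?V)" using I by blast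
next
  fix I assume "I \<in> ?X - (?U \<union> ?V)"
  then have I: "I \<in> ?X" "I \<notin> ?U" "I \<notin> ?V" by auto
  obtain i where i: "(i, Suc a) \<in> I"
    using ics_below_last_column[OF I(1,2)] .
  have notb: "(1, b) \<notin> I"
  proof (cases b)
    case 0
    then show ?thesis using ics_below_bounds[OF I(1), of 1 b] by auto
  next
    case (Suc b')
    then show ?thesis using I ics_below_violation[of I m "Suc a" b'] by auto
  qed
  have "(1, j) \<in> I \<longleftrightarrow> b < j \<and> j \<le> Suc a" for j
  proof
    assume j: "(1, j) \<in> I"
    have top: "(1, Suc a) \<in> I" using ics_below_row[OF I(1) i] b by simp
    have "b < j"
    proof (rule ccontr)
      assume "\<not> b < j"
      then show False
        using box_convexD[OF ics_below_convex[OF I(1)] j top, of 1 b] notb b by simp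
    qed
    then show "b < j \<and> j \<le> Suc a" using ics_below_bounds[OF I(1) j] by simp
  next
    assume "b < j \<and> j \<le> Suc a"
    then show "(1, j) \<in> I" using ics_below_row[OF I(1) i] by simp
  qed
  then show "I \<in> ?Y" using I by (simp add: ics_first_row_def)
qed

lemma card_ics_below_rec_0:
  "card (ics_below (Suc m) (Suc a) 0) = card (ics_below (Suc m) a 0) + card (ics_below m (Suc a) 0)"
proof -
  have "card (ics_first_row (Suc m) (Suc a) 0) = card (ics_below (Suc m) (Suc a) 0) - card (ics_below (Suc m) a 0)"
    by (simp add: ics_first_row_eq card_Diff_subset ics_below_mono)
  moreover have "card (ics_below (Suc m) a 0) \<le> card (ics_below (Suc m) (Suc a) 0)"
    by (simp add: card_mono ics_below_mono)
  ultimately show ?thesis by (simp add: card_ics_first_row)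
qed

lemma card_ics_below_rec:
  assumes "b < a"
  shows "card (ics_below (Suc m) (Suc a) (Suc b)) + card (ics_below (Suc m) a b) =
    card (ics_below (Suc m) a (Suc b)) + card (ics_below (Suc m) (Suc a) b) + card (ics_below m (Suc a) (Suc b))"
proof -
  let ?X = "ics_below (Suc m)"
  have sub: "?X a (Suc b) \<union> ?X (Suc a) b \<subseteq> ?X (Suc a) (Suc b)"
    by (simp add: ics_below_mono)
  have "card (ics_first_row (Suc m) (Suc a) (Suc b)) = card (?X (Suc a) (Suc b)) - card (?X a (Suc b) \<union> ?X (Suc a) b)"
    using assms sub by (simp add: ics_first_row_eq card_Diff_subset)
  moreover have "card (?X a (Suc b) \<union> ?X (Suc a) b) \<le> card (?X (Suc a) (Suc b))"
    using sub by (simp add: card_mono)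
  moreover have "card (?X a (Suc b)) + card (?X (Suc a) b) = card (?X a (Suc b) \<union> ?X (Suc a) b) + card (?X a b)"
    using card_Un_Int[of "?X a (Suc b)" "?X (Suc a) b"] by (simp add: ics_below_Int)
  ultimately show ?thesis using assms by (simp add: card_ics_first_row)
qed

text \<open>
  If \<open>I\<close> violates the condition for \<open>b = a\<close> in a rectangle with \<open>a + 1\<close> columns, then it has a
  point in the last column but lacks \<open>(1, a + 1)\<close>.  By convexity the first row is then empty.
  Conversely, a set with empty first row satisfies the condition exactly if it avoids the last
  column.
\<close>

lemma card_ics_below_rec_diagonal:
  "card (ics_below (Suc m) (Suc a) (Suc a)) + card (ics_below m a a) =
    card (ics_below (Suc m) (Suc a) a) + card (ics_below m (Suc a) (Suc a))"
proof -
  let ?X = "ics_below (Suc m)" and ?Y = "ics_first_row (Suc m)"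
  have Y: "I \<in> ?Y c c \<longleftrightarrow> I \<in> ?X c c \<and> (\<forall>j. (1, j) \<notin> I)" for I c
  proof -
    have "\<not> (c < j \<and> j \<le> c)" for j by simp
    then show ?thesis unfolding ics_first_row_def by blast
  qed
  have "?X (Suc a) (Suc a) = ?X (Suc a) a \<union> ?Y (Suc a) (Suc a)"
  proof (intro equalityI subsetI)
    fix I assume I: "I \<in> ?X (Suc a) (Suc a)"
    show "I \<in> ?X (Suc a) a \<union> ?Y (Suc a) (Suc a)"
    proof (cases "I \<in> ?X (Suc a) a")
      case False
      then obtain i j where *: "(i, j) \<in> I" "a < j" "(1, Suc a) \<notin> I"
        using ics_below_violation[OF I] by blast
      have "(1, q) \<notin> I" for q
      proof
        assume q: "(1, q) \<in> I"
        show False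
          using box_convexD[OF ics_below_convex[OF I] q *(1), of 1 "Suc a"] *
            ics_below_bounds[OF I q] ics_below_bounds[OF I *(1)] by simp
      qed
      then show ?thesis using I Y by blast
    qed simp
  next
    fix I assume "I \<in> ?X (Suc a) a \<union> ?Y (Suc a) (Suc a)"
    then show "I \<in> ?X (Suc a) (Suc a)"
      using ics_below_mono[of "Suc a" "Suc a" a "Suc a" "Suc m"] Y by auto
  qed
  moreover have "?X (Suc a) a \<inter> ?Y (Suc a) (Suc a) = ?Y a a"
  proof (intro equalityI subsetI)
    fix I assume "I \<in> ?X (Suc a) a \<inter> ?Y (Suc a) (Suc a)"
    then have I: "I \<in> ?X (Suc a) a" "\<forall>j. (1, j) \<notin> I" using Y by auto
    have "(i, Suc a) \<notin> I" for i
      using ics_below_row[OF I(1), of i "Suc a" "Suc a"] I(2) by auto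
    then have "I \<in> ?X a a"
      using ics_below_last_column[OF I(1)] by blast
    then show "I \<in> ?Y a a" using I(2) Y by blast
  next
    fix I assume "I \<in> ?Y a a"
    then show "I \<in> ?X (Suc a) a \<inter> ?Y (Suc a) (Suc a)"
      using ics_below_mono[of a "Suc a" a a "Suc m"] ics_below_mono[of a "Suc a" a "Suc a" "Suc m"]
      by (auto simp: Y)
  qed
  moreover have "finite (?Y (Suc a) (Suc a))" by (simp add: ics_first_row_def)
  ultimately show ?thesis
    using card_Un_Int[of "?X (Suc a) a" "?Y (Suc a) (Suc a)"] by (simp add: card_ics_first_row)
qed

section \<open>The generating function\<close>

lemma fps_x_mult_nth: "(fps_x * F) $ m $ n = (case m of 0 \<Rightarrow> 0 | Suc m' \<Rightarrow> F $ m' $ n)"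
  by (simp add: fps_x_def split: nat.split)

lemma fps_y_mult_nth: "(fps_y * F) $ m $ n = (case n of 0 \<Rightarrow> 0 | Suc n' \<Rightarrow> F $ m $ n')"
  by (simp add: fps_y_def split: nat.split)

text \<open>
  The equations compute the coefficient of \<open>x ^ m * y ^ n\<close> in \<open>R k\<close> from coefficients with smaller
  \<open>m\<close>, or the same \<open>m\<close> and smaller \<open>n\<close>, or the same \<open>m\<close> and \<open>n\<close> and smaller \<open>k\<close>.  This is
  the order of the three nested inductions, and in it the cardinalities obey the same recurrences.
\<close>

lemma ics_below_series:
  fixes R :: "nat \<Rightarrow> rat fps fps"
  assumes R0: "R 0 = 1 + fps_x * R 0 - fps_x * (fps_y * R 0) + fps_y * R 1"
    and RS: "\<And>k. R (Suc k) = R k + fps_x * R (Suc k) + fps_y * R (Suc (Suc k)) - fps_y * R (Suc k)"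
  shows "R k $ m $ n = of_nat (card (ics_below m (n + k) n))"
proof -
  have R0': "R 0 $ m $ n = (1 :: rat fps fps) $ m $ n + (fps_x * R 0) $ m $ n
      - (fps_x * (fps_y * R 0)) $ m $ n + (fps_y * R 1) $ m $ n" for m n
    by (subst R0) (simp only: fps_add_nth fps_sub_nth)
  have RS': "R (Suc k) $ m $ n = R k $ m $ n + (fps_x * R (Suc k)) $ m $ n
      + (fps_y * R (Suc (Suc k))) $ m $ n - (fps_y * R (Suc k)) $ m $ n" for k m n
    by (subst RS) (simp only: fps_add_nth fps_sub_nth)
  have R0_coeff:
    "R 0 $ 0 $ 0 = 1"
    "R 0 $ 0 $ Suc n = R 1 $ 0 $ n"
    "R 0 $ Suc m $ 0 = R 0 $ m $ 0"
    "R 0 $ Suc m $ Suc n = R 0 $ m $ Suc n - R 0 $ m $ n + R 1 $ Suc m $ n" for m n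
    by (subst R0', simp only: fps_x_mult_nth fps_y_mult_nth nat.case, simp)+
  have RS_coeff:
    "R (Suc k) $ 0 $ 0 = R k $ 0 $ 0"
    "R (Suc k) $ 0 $ Suc n = R k $ 0 $ Suc n + R (Suc (Suc k)) $ 0 $ n - R (Suc k) $ 0 $ n"
    "R (Suc k) $ Suc m $ 0 = R k $ Suc m $ 0 + R (Suc k) $ m $ 0"
    "R (Suc k) $ Suc m $ Suc n = R k $ Suc m $ Suc n + R (Suc k) $ m $ Suc n
       + R (Suc (Suc k)) $ Suc m $ n - R (Suc k) $ Suc m $ n" for k m n
    by (subst RS', simp only: fps_x_mult_nth fps_y_mult_nth nat.case add_0_right diff_zero)+
  let ?d = "\<lambda>m a b. of_nat (card (ics_below m a b)) :: rat"
  have d_empty: "?d 0 a b = 1" "?d m 0 b = 1" for m a b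
    by (simp_all add: ics_below_empty)
  have d_0: "?d (Suc m) (Suc a) 0 = ?d (Suc m) a 0 + ?d m (Suc a) 0" for m a
    by (simp add: card_ics_below_rec_0)
  have d_diagonal: "?d (Suc m) (Suc a) (Suc a) =
      ?d m (Suc a) (Suc a) - ?d m a a + ?d (Suc m) (Suc a) a" for m a
    using arg_cong[OF card_ics_below_rec_diagonal[of m a], of "of_nat :: nat \<Rightarrow> rat"]
    unfolding of_nat_add by linarith
  have d_Suc: "?d (Suc m) (Suc a) (Suc b) =
      ?d (Suc m) a (Suc b) + ?d m (Suc a) (Suc b) + ?d (Suc m) (Suc a) b - ?d (Suc m) a b"
    if "b < a" for m a b
    using arg_cong[OF card_ics_below_rec[OF that, of m], of "of_nat :: nat \<Rightarrow> rat"]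
    unfolding of_nat_add by linarith
  show ?thesis
  proof (induction m arbitrary: n k)
    case 0
    show ?case
    proof (induction n arbitrary: k)
      case 0
      show ?case by (induction k) (simp_all only: R0_coeff RS_coeff d_empty)
    next
      case (Suc n)
      then have IHn: "R k $ 0 $ n = 1" for k by (simp only: d_empty)
      have "R k $ 0 $ Suc n = 1" for k
        by (induction k) (simp_all only: R0_coeff RS_coeff IHn add_diff_cancel_right')
      then show ?case by (simp only: d_empty)
    qed
  next
    case (Suc m)
    note IHm = Suc
    show ?case
    proof (induction n arbitrary: k)
      case 0
      show ?case
      proof (induction k)
        case 0
        show ?case by (simp only: R0_coeff IHm d_empty add_0)
      next
        case (Suc k)
        then show ?case by (simp only: RS_coeff IHm d_0 add_0)
      qed
    next
      case (Suc n)
      note IHn = Suc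
      show ?case
      proof (induction k)
        case 0
        have "R 0 $ Suc m $ Suc n = ?d m (Suc n) (Suc n) - ?d m n n + ?d (Suc m) (Suc n) n"
          using IHm[of 0 "Suc n"] IHm[of 0 n] IHn[of "Suc 0"] by (simp add: R0_coeff)
        then show ?case by (simp only: d_diagonal add_0_right)
      next
        case (Suc k)
        have "R (Suc k) $ Suc m $ Suc n = ?d (Suc m) (Suc n + k) (Suc n)
            + ?d m (Suc n + Suc k) (Suc n) + ?d (Suc m) (n + Suc (Suc k)) n
            - ?d (Suc m) (n + Suc k) n"
          by (simp only: RS_coeff IHm IHn Suc)
        also have "\<dots> = ?d (Suc m) (Suc (n + Suc k)) (Suc n)"
          using d_Suc[of n "n + Suc k" m] by simp
        finally show ?case by (simp only: add_Suc)
      qed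
    qed
  qed
qed

text \<open>
  The defining equation of \<open>M\<close> is rationalised: isolating \<open>M * S\<close> and squaring removes the radical
  and leaves four times the quadratic equation.
\<close>

lemma radical_quadratic:
  fixes x y M S :: "'a::idom"
  assumes two: "(2::'a) \<noteq> 0"
    and S: "S\<^sup>2 = (1 - x - y)\<^sup>2 - 4 * x * y"
    and M: "M * (1 - x - y + S) = 2"
  shows "M = 1 + (x + y) * M + x * y * M\<^sup>2" and "S = (1 - x - y) - 2 * x * y * M"
proof -
  have MS: "M * S = 2 - (1 - x - y) * M"
    using M by (simp add: algebra_simps)
  have "M\<^sup>2 * S\<^sup>2 = (2 - (1 - x - y) * M)\<^sup>2"
    using arg_cong[OF MS, of "\<lambda>u. u\<^sup>2"] by (simp add: power_mult_distrib)
  then have "(2 * 2) * (1 + (x + y) * M + x * y * M\<^sup>2 - M) = 0"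
    unfolding S by (simp add: power2_eq_square algebra_simps)
  then have quad: "1 + (x + y) * M + x * y * M\<^sup>2 - M = 0"
    using two by (simp only: mult_eq_0_iff simp_thms)
  then show "M = 1 + (x + y) * M + x * y * M\<^sup>2"
    by (simp only: right_minus_eq)
  have "M * (S - ((1 - x - y) - 2 * x * y * M)) = 2 * (1 + (x + y) * M + x * y * M\<^sup>2 - M)"
    using MS by (simp add: power2_eq_square algebra_simps)
  also have "\<dots> = 0" by (simp only: quad mult_zero_right)
  finally have "M * (S - ((1 - x - y) - 2 * x * y * M)) = 0" .
  moreover have "M \<noteq> 0" using M two by auto
  ultimately show "S = (1 - x - y) - 2 * x * y * M" by simp
qed

theorem theorem3p5:
  shows "Abs_fps (\<lambda>m. Abs_fps (\<lambda>n. of_nat (card (\<I>\<C> (chain_product m n))))) =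
    2 / (1 - fps_x - fps_y + 2 * fps_x * fps_y
         + fps2_sqrt ((1 - fps_x - fps_y)\<^sup>2 - 4 * fps_x * fps_y))"
proof -
  define x y where xy: "x = fps_x" "y = fps_y"
  define S where "S = fps2_sqrt ((1 - x - y)\<^sup>2 - 4 * x * y)"
  define M where "M = 2 / (1 - x - y + S)"
  define F where "F = 2 / (1 - x - y + 2 * x * y + S)"
  define t where "t = 1 + x * M"
  have nth0: "x $ 0 = 0" "y $ 0 $ 0 = 0"
    by (simp_all add: xy fps_x_def fps_y_def)
  have "((1 - x - y)\<^sup>2 - 4 * x * y) $ 0 $ 0 = 1"
    by (simp add: nth0 power2_eq_square)
  then have S: "S\<^sup>2 = (1 - x - y)\<^sup>2 - 4 * x * y" "S $ 0 $ 0 = 1"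
    unfolding S_def by (rule fps2_sqrt)+
  have M: "M * (1 - x - y + S) = 2"
    using fps2_divide_eq_iff[of "1 - x - y + S" M 2] S by (simp add: M_def nth0)
  have F: "F * (1 - x - y + 2 * x * y + S) = 2"
    using fps2_divide_eq_iff[of "1 - x - y + 2 * x * y + S" F 2] S by (simp add: F_def nth0)
  have Mquad: "M = 1 + (x + y) * M + x * y * M\<^sup>2" and S_eq: "S = (1 - x - y) - 2 * x * y * M"
    by (rule radical_quadratic[OF _ S(1) M], simp)+
  have "2 * (F * (1 - x + x * y - y * t)) = 2 * 1"
    using F by (simp add: S_eq t_def algebra_simps)
  then have Ft: "F * (1 - x + x * y - y * t) = 1"
    by (metis mult_cancel_left zero_neq_numeral)
  have t: "t = 1 + x * t + y * t\<^sup>2 - y * t"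
  proof -
    have "1 + x * t + y * t\<^sup>2 - y * t - t = x * (1 + (x + y) * M + x * y * M\<^sup>2 - M)"
      by (simp add: t_def power2_eq_square algebra_simps)
    also have "\<dots> = 0"
      by (simp only: Mquad[symmetric] diff_self mult_zero_right)
    finally show ?thesis by (simp only: right_minus_eq)
  qed
  have coeff: "(F * t ^ k) $ m $ n = of_nat (card (ics_below m (n + k) n))" for k m n
  proof (rule ics_below_series)
    show "F * t ^ 0 = 1 + fps_x * (F * t ^ 0) - fps_x * (fps_y * (F * t ^ 0)) + fps_y * (F * t ^ 1)"
      using Ft by (simp add: xy algebra_simps)
    show "F * t ^ Suc k = F * t ^ k + fps_x * (F * t ^ Suc k) + fps_y * (F * t ^ Suc (Suc k))
        - fps_y * (F * t ^ Suc k)" for k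
      using arg_cong[OF t, of "\<lambda>u. F * t ^ k * u"]
      by (simp add: xy algebra_simps power2_eq_square)
  qed
  have "Abs_fps (\<lambda>m. Abs_fps (\<lambda>n. of_nat (card (\<I>\<C> (chain_product m n))))) = F"
    using coeff[of 0] by (simp add: fps_eq_iff ics_below_diagonal)
  then show ?thesis by (simp only: F_def S_def xy)
qed

end
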